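(* Let $\nu$ be a Lévy measure on $\mathbb R^d$ with $\int_{\mathbb R^d}\|x\|^3\nu(dx)<\infty$, and assume that there exist $C>0$ and $\alpha\in(0,2)$ such that $\nu(\{x:\|x\|>r\})\sim Cr^{-\alpha}$ as $r\to0$. For $\varepsilon>0$ let $\nu_\varepsilon$ be the measure of the 3-moment scheme (defined in the context) and $\lambda_\varepsilon=\nu_\varepsilon(\mathbb R^d)$. For $N>0$ let $$\mathcal M^N=\{\nu'\ \text{Lévy measure on }\mathbb R^d:\ \nu'(\mathbb R^d)\le N\}.$$ Then $$\limsup_{\varepsilon\downarrow0}\frac{\int_{\mathbb R^d}\|x\|^4\,|d\nu-d\nu_\varepsilon|}{\inf_{\nu'\in\mathcal M^{\lambda_\varepsilon}}\int_{\mathbb R^d}\|x\|^4\,|d\nu-d\nu'|}<\infty.$$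
   Context: A Lévy measure is a measure $\nu$ on $\mathbb R^d$ with $\nu(\{0\})=0$ and $\int(1\wedge\|x\|^2)\nu(dx)<\infty$. $f\sim g$ means $\lim f/g=1$. $|d\nu-d\nu'|$ denotes integration against the total variation of $\nu-\nu'$, i.e. against $|p-p'|\,d\rho$ where $p,p'$ are the densities of $\nu,\nu'$ with respect to $\rho=\nu+\nu'$. 3-moment scheme: let $S^{d-1}$ be the unit sphere of $\mathbb R^d$; write $\nu(dr,d\theta)$ for $\nu$ in spherical coordinates $x=r\theta$, $r\in[0,\infty)$, $\theta\in S^{d-1}$, and let $\bar\nu(B)=\nu(\{x:-x\in B\})$. Put $$\bar\lambda(d\theta)=\tfrac12\int_{r\le\varepsilon}\frac{r^3}{\varepsilon^3}\bigl(\nu(dr,d\theta)-\bar\nu(dr,d\theta)\bigr),\qquad \lambda(d\theta)=\tfrac12\int_{r\le\varepsilon}\frac{r^2}{\varepsilon^2}\bigl(\nu(dr,d\theta)+\bar\nu(dr,d\theta)\bigr),$$ $$\nu_\varepsilon(dr,d\theta)=\nu(dr,d\theta)\,1_{r>\varepsilon}+\delta_\varepsilon(dr)\,\{\lambda(d\theta)+\bar\lambda(d\theta)\},$$ with $\delta_\varepsilon$ the point mass at $\varepsilon$. *)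

theory Defs
  imports "HOL-Analysis.Analysis" "HOL-Library.Landau_Symbols"
begin

definition levy_measure :: "'a::euclidean_space measure \<Rightarrow> bool" where
  "levy_measure \<nu> \<longleftrightarrow>
     sets \<nu> = sets borel \<and> emeasure \<nu> {0} = 0 \<and>
     (\<integral>\<^sup>+ x. ennreal (min 1 ((norm x)\<^sup>2)) \<partial>\<nu>) < \<infinity>"

definition sum_measure :: "'a measure \<Rightarrow> 'a measure \<Rightarrow> 'a measure" where
  "sum_measure M N = measure_of (space M) (sets M) (\<lambda>A. emeasure M A + emeasure N A)"

lemma space_sum_measure [simp]: "space (sum_measure M N) = space M"
  and sets_sum_measure [simp, measurable_cong]: "sets (sum_measure M N) = sets M"
  unfolding sum_measure_def by simp_all

lemma emeasure_sum_measure: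
  assumes "sets N = sets M" "A \<in> sets M"
  shows "emeasure (sum_measure M N) A = emeasure M A + emeasure N A"
proof (rule emeasure_measure_of[OF sum_measure_def])
  show "countably_additive (sets (sum_measure M N)) (\<lambda>A. emeasure M A + emeasure N A)"
    unfolding countably_additive_def using assms(1)
    by (auto simp flip: suminf_add simp: suminf_emeasure)
qed (use assms sets.sets_into_space in \<open>auto simp: positive_def\<close>)

text \<open>
  \<open>tv_integral f \<mu> \<mu>'\<close> is the integral of \<open>f\<close> against \<open>|d\<mu> - d\<mu>'|\<close>. The densities
  with respect to \<open>\<rho> = \<mu> + \<mu>'\<close> are almost everywhere at most 1 when \<open>\<rho>\<close> is \<open>\<sigma>\<close>-finite,
  so passing to real numbers loses nothing for Levy measures.
\<close>

definition tv_integral :: "('a \<Rightarrow> real) \<Rightarrow> 'a measure \<Rightarrow> 'a measure \<Rightarrow> ennreal" where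
  "tv_integral f \<mu> \<mu>' =
     (let \<rho> = sum_measure \<mu> \<mu>' in
      \<integral>\<^sup>+ x. ennreal (f x * \<bar>enn2real (RN_deriv \<rho> \<mu> x) - enn2real (RN_deriv \<rho> \<mu>' x)\<bar>) \<partial>\<rho>)"

definition reflected :: "'a::euclidean_space measure \<Rightarrow> 'a measure" where
  "reflected \<nu> = distr \<nu> borel uminus"

text \<open>
  In spherical coordinates \<open>x = r \<theta>\<close> one has \<open>r = norm x\<close> and, for \<open>x \<noteq> 0\<close>,
  \<open>\<theta> = sgn x = x /\<^sub>R norm x\<close>; the origin carries no mass.
  \<open>radial_moment k \<epsilon> \<nu> B\<close> is the value at \<open>B \<subseteq> sphere 0 1\<close> of the measure
  \<open>\<integral>\<^bsub>r \<le> \<epsilon>\<^esub> (r^k / \<epsilon>^k) \<nu>(dr, d\<theta>)\<close> on the unit sphere.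
\<close>

definition radial_moment :: "nat \<Rightarrow> real \<Rightarrow> 'a::euclidean_space measure \<Rightarrow> 'a set \<Rightarrow> real" where
  "radial_moment k \<epsilon> \<nu> B =
     (LINT x:{x. norm x \<le> \<epsilon> \<and> sgn x \<in> B}|\<nu>. norm x ^ k / \<epsilon> ^ k)"

definition lambda_bar :: "real \<Rightarrow> 'a::euclidean_space measure \<Rightarrow> 'a set \<Rightarrow> real" where
  "lambda_bar \<epsilon> \<nu> B = (radial_moment 3 \<epsilon> \<nu> B - radial_moment 3 \<epsilon> (reflected \<nu>) B) / 2"

definition lambda :: "real \<Rightarrow> 'a::euclidean_space measure \<Rightarrow> 'a set \<Rightarrow> real" where
  "lambda \<epsilon> \<nu> B = (radial_moment 2 \<epsilon> \<nu> B + radial_moment 2 \<epsilon> (reflected \<nu>) B) / 2"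

text \<open>
  The mass that \<open>\<delta>\<^sub>\<epsilon>(dr) \<mu>(d\<theta>)\<close> gives to a set \<open>A\<close> is
  \<open>\<mu> {\<theta> \<in> sphere 0 1. \<epsilon> *\<^sub>R \<theta> \<in> A}\<close>. Although \<open>lambda_bar\<close> is signed,
  \<open>lambda + lambda_bar\<close> is a finite nonnegative measure: see \<open>emeasure_three_moment\<close> below.
\<close>

definition three_moment :: "real \<Rightarrow> 'a::euclidean_space measure \<Rightarrow> 'a measure" where
  "three_moment \<epsilon> \<nu> = measure_of UNIV (sets borel)
     (\<lambda>A. emeasure \<nu> (A \<inter> {x. norm x > \<epsilon>}) +
          (let B = {\<theta> \<in> sphere 0 1. \<epsilon> *\<^sub>R \<theta> \<in> A} in
           ennreal (lambda \<epsilon> \<nu> B + lambda_bar \<epsilon> \<nu> B)))"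

definition levy_measures_le :: "ennreal \<Rightarrow> 'a::euclidean_space measure set" where
  "levy_measures_le N = {\<nu>. levy_measure \<nu> \<and> emeasure \<nu> UNIV \<le> N}"

lemma space_three_moment [simp]: "space (three_moment \<epsilon> \<nu>) = UNIV"
  and sets_three_moment [simp, measurable_cong]: "sets (three_moment \<epsilon> \<nu>) = sets borel"
  unfolding three_moment_def by (simp_all add: sets.sigma_sets_eq[of borel, simplified])

lemma levy_measure_reflected:
  fixes \<nu> :: "'a::euclidean_space measure"
  assumes "levy_measure \<nu>"
  shows "levy_measure (reflected \<nu>)"
proof -
  have s [measurable_cong]: "sets \<nu> = sets borel" using assms by (simp add: levy_measure_def)
  have sp: "space \<nu> = UNIV" using sets_eq_imp_space_eq[OF s] by simp
  have "uminus -` {0::'a} = {0}" by auto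
  then show ?thesis using assms sp
    by (simp add: levy_measure_def reflected_def emeasure_distr nn_integral_distr)
qed

lemma radial_moment_integrable:
  fixes \<nu> :: "'a::euclidean_space measure"
  assumes lm: "levy_measure \<nu>" and e: "\<epsilon> > 0" and k: "k \<ge> 2" and B [measurable]: "B \<in> sets borel"
  shows "set_integrable \<nu> {x. norm x \<le> \<epsilon> \<and> sgn x \<in> B} (\<lambda>x. norm x ^ k / \<epsilon> ^ k)"
proof -
  have s [measurable_cong]: "sets \<nu> = sets borel" using lm by (simp add: levy_measure_def)
  have fin: "(\<integral>\<^sup>+ x. ennreal (min 1 ((norm x)\<^sup>2)) \<partial>\<nu>) < \<infinity>"
    using lm by (simp add: levy_measure_def)
  have int: "integrable \<nu> (\<lambda>x. min 1 ((norm x)\<^sup>2))"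
    by (rule integrableI_nonneg) (use fin in auto)
  have sgnm [measurable]: "sgn \<in> borel_measurable (borel :: 'a measure)"
    unfolding sgn_div_norm by measurable
  show ?thesis unfolding set_integrable_def
  proof (rule Bochner_Integration.integrable_bound[OF integrable_mult_right[OF int, of "max 1 (1 / \<epsilon>\<^sup>2)"]])
    show "AE x in \<nu>. norm (indicat_real {x. norm x \<le> \<epsilon> \<and> sgn x \<in> B} x *\<^sub>R (norm x ^ k / \<epsilon> ^ k))
        \<le> norm (max 1 (1 / \<epsilon>\<^sup>2) * min 1 ((norm x)\<^sup>2))"
    proof (intro AE_I2)
      fix x :: "'a"
      have nn: "0 \<le> max 1 (1 / \<epsilon>\<^sup>2) * min 1 ((norm x)\<^sup>2)" by (simp add: max_def)
      show "norm (indicat_real {x. norm x \<le> \<epsilon> \<and> sgn x \<in> B} x *\<^sub>R (norm x ^ k / \<epsilon> ^ k))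
        \<le> norm (max 1 (1 / \<epsilon>\<^sup>2) * min 1 ((norm x)\<^sup>2))"
      proof (cases "norm x \<le> \<epsilon> \<and> sgn x \<in> B")
        case True
        define u where "u = norm x / \<epsilon>"
        have u: "0 \<le> u" "u \<le> 1" using True e by (auto simp: u_def)
        have "norm x ^ k / \<epsilon> ^ k = u ^ k" by (simp add: u_def power_divide)
        also have "\<dots> \<le> u ^ 2" using u k by (intro power_decreasing) auto
        also have "\<dots> \<le> max 1 (1 / \<epsilon>\<^sup>2) * min 1 ((norm x)\<^sup>2)"
        proof (cases "(norm x)\<^sup>2 \<le> 1")
          case True
          have "u\<^sup>2 = 1 / \<epsilon>\<^sup>2 * (norm x)\<^sup>2" by (simp add: u_def power_divide)
          also have "\<dots> \<le> max 1 (1 / \<epsilon>\<^sup>2) * (norm x)\<^sup>2" by (intro mult_right_mono) auto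
          finally show ?thesis using True by (simp add: min_def)
        next
          case False
          have "u\<^sup>2 \<le> 1" using u by (simp add: power_le_one)
          then show ?thesis using False by (simp add: min_def max_def)
        qed
        finally have "norm x ^ k / \<epsilon> ^ k \<le> max 1 (1 / \<epsilon>\<^sup>2) * min 1 ((norm x)\<^sup>2)" .
        then show ?thesis using True e nn by (simp del: mult_nonneg_nonneg)
      next
        case False
        then show ?thesis by (simp only: indicator_def) auto
      qed
    qed
  qed measurable
qed

lemma emeasure_three_moment:
  fixes \<nu> :: "'a::euclidean_space measure"
  assumes lm: "levy_measure \<nu>" and e: "\<epsilon> > 0" and A: "A \<in> sets borel"
  defines "B \<equiv> {\<theta> \<in> sphere 0 1. \<epsilon> *\<^sub>R \<theta> \<in> A}"
  shows "lambda \<epsilon> \<nu> B + lambda_bar \<epsilon> \<nu> B \<ge> 0"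
    and "emeasure (three_moment \<epsilon> \<nu>) A =
      emeasure \<nu> (A \<inter> {x. norm x > \<epsilon>}) + ennreal (lambda \<epsilon> \<nu> B + lambda_bar \<epsilon> \<nu> B)"
proof -
  have sgnm [measurable]: "sgn \<in> borel_measurable (borel :: 'a measure)"
    unfolding sgn_div_norm by measurable
  have s [measurable_cong]: "sets \<nu> = sets borel" using lm by (simp add: levy_measure_def)
  have sp: "space \<nu> = UNIV" using sets_eq_imp_space_eq[OF s] by simp
  have lm': "levy_measure (reflected \<nu>)" by (rule levy_measure_reflected[OF lm])
  have s' [measurable_cong]: "sets (reflected \<nu>) = sets borel" by (simp add: reflected_def)
  have sp': "space (reflected \<nu>) = UNIV" by (simp add: reflected_def)
  define S where "S A = {\<theta> \<in> sphere 0 1. \<epsilon> *\<^sub>R \<theta> \<in> A}" for A :: "'a set"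
  define D where "D A = {x. norm x \<le> \<epsilon> \<and> sgn x \<in> S A}" for A :: "'a set"
  define p where "p x = (norm x ^ 2 / \<epsilon> ^ 2 + norm x ^ 3 / \<epsilon> ^ 3) / 2" for x :: 'a
  define q where "q x = (norm x ^ 2 / \<epsilon> ^ 2 - norm x ^ 3 / \<epsilon> ^ 3) / 2" for x :: 'a
  have Sm [measurable]: "S A \<in> sets borel" if [measurable]: "A \<in> sets borel" for A
    unfolding S_def by measurable
  have Dm [measurable]: "D A \<in> sets borel" if [measurable]: "A \<in> sets borel" for A
    unfolding D_def by measurable
  have pm [measurable]: "p \<in> borel_measurable borel" and qm [measurable]: "q \<in> borel_measurable borel"
    unfolding p_def q_def by measurable
  have p0: "p x \<ge> 0" for x using e by (simp add: p_def)
  have q0: "q x \<ge> 0" if "norm x \<le> \<epsilon>" for x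
  proof -
    have "(norm x / \<epsilon>) ^ 3 \<le> (norm x / \<epsilon>) ^ 2" using that e by (intro power_decreasing) auto
    then show ?thesis by (simp add: q_def power_divide)
  qed
  have key: "lambda \<epsilon> \<nu> (S A) + lambda_bar \<epsilon> \<nu> (S A) \<ge> 0 \<and>
     ennreal (lambda \<epsilon> \<nu> (S A) + lambda_bar \<epsilon> \<nu> (S A)) =
     (\<integral>\<^sup>+ x. ennreal (p x) * indicator (D A) x \<partial>\<nu>) + (\<integral>\<^sup>+ x. ennreal (q x) * indicator (D A) x \<partial>reflected \<nu>)"
    if A [measurable]: "A \<in> sets borel" for A
  proof -
    note i = radial_moment_integrable[OF _ e _ Sm[OF A], folded D_def]
    have ip: "set_integrable \<nu> (D A) p" unfolding p_def
      using i[OF lm, of 2] i[OF lm, of 3] by (intro set_integrable_divide set_integral_add) auto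
    have iq: "set_integrable (reflected \<nu>) (D A) q" unfolding q_def
      using i[OF lm', of 2] i[OF lm', of 3] by (intro set_integrable_divide set_integral_diff) auto
    have vp: "(LINT x:D A|\<nu>. p x) = (radial_moment 2 \<epsilon> \<nu> (S A) + radial_moment 3 \<epsilon> \<nu> (S A)) / 2"
      unfolding p_def radial_moment_def D_def[symmetric]
      using i[OF lm, of 2] i[OF lm, of 3] by (simp add: set_integral_add)
    have vq: "(LINT x:D A|reflected \<nu>. q x) =
        (radial_moment 2 \<epsilon> (reflected \<nu>) (S A) - radial_moment 3 \<epsilon> (reflected \<nu>) (S A)) / 2"
      unfolding q_def radial_moment_def D_def[symmetric]
      using i[OF lm', of 2] i[OF lm', of 3] by (simp add: set_integral_diff)
    have sum: "lambda \<epsilon> \<nu> (S A) + lambda_bar \<epsilon> \<nu> (S A) =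
        (LINT x:D A|\<nu>. p x) + (LINT x:D A|reflected \<nu>. q x)"
      unfolding vp vq lambda_def lambda_bar_def by (simp add: field_simps)
    have np: "(LINT x:D A|\<nu>. p x) \<ge> 0" unfolding set_lebesgue_integral_def
      by (intro Bochner_Integration.integral_nonneg) (auto simp: p0)
    have nq: "(LINT x:D A|reflected \<nu>. q x) \<ge> 0" unfolding set_lebesgue_integral_def
      by (intro Bochner_Integration.integral_nonneg) (auto simp: q0 D_def indicator_def)
    have ep: "(\<integral>\<^sup>+ x. ennreal (p x) * indicator (D A) x \<partial>\<nu>) = ennreal (LINT x:D A|\<nu>. p x)"
    proof -
      have "(\<integral>\<^sup>+ x. ennreal (p x) * indicator (D A) x \<partial>\<nu>) =
          (\<integral>\<^sup>+ x. ennreal (indicator (D A) x *\<^sub>R p x) \<partial>\<nu>)"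
        by (intro nn_integral_cong) (auto simp: indicator_def)
      also have "\<dots> = ennreal (LINT x:D A|\<nu>. p x)" unfolding set_lebesgue_integral_def
        using ip by (intro nn_integral_eq_integral) (auto simp: set_integrable_def p0)
      finally show ?thesis .
    qed
    have eq: "(\<integral>\<^sup>+ x. ennreal (q x) * indicator (D A) x \<partial>reflected \<nu>) = ennreal (LINT x:D A|reflected \<nu>. q x)"
    proof -
      have "(\<integral>\<^sup>+ x. ennreal (q x) * indicator (D A) x \<partial>reflected \<nu>) =
          (\<integral>\<^sup>+ x. ennreal (indicator (D A) x *\<^sub>R q x) \<partial>reflected \<nu>)"
        by (intro nn_integral_cong) (auto simp: indicator_def)
      also have "\<dots> = ennreal (LINT x:D A|reflected \<nu>. q x)" unfolding set_lebesgue_integral_def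
        using iq by (intro nn_integral_eq_integral) (auto simp: set_integrable_def q0 D_def indicator_def)
      finally show ?thesis .
    qed
    show ?thesis unfolding ep eq sum using np nq by simp
  qed
  show "lambda \<epsilon> \<nu> B + lambda_bar \<epsilon> \<nu> B \<ge> 0" using key[OF A] by (simp add: B_def S_def)
  define F where "F A = emeasure \<nu> (A \<inter> {x. norm x > \<epsilon>}) + ennreal (lambda \<epsilon> \<nu> (S A) + lambda_bar \<epsilon> \<nu> (S A))"
    for A
  define G where "G A = emeasure \<nu> (A \<inter> {x. norm x > \<epsilon>}) + (emeasure (density \<nu> p) (D A) +
     emeasure (density (reflected \<nu>) q) (D A))" for A
  have FG: "F A = G A" if [measurable]: "A \<in> sets borel" for A
    unfolding F_def G_def using key[OF that] by (simp add: emeasure_density)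
  have tm: "three_moment \<epsilon> \<nu> = measure_of UNIV (sets borel) F"
    unfolding three_moment_def F_def[abs_def] S_def Let_def ..
  have "emeasure (three_moment \<epsilon> \<nu>) A = F A"
  proof (rule emeasure_measure_of[OF tm])
    show "positive (sets (three_moment \<epsilon> \<nu>)) F"
      using FG[of "{}"] by (simp add: positive_def G_def D_def S_def)
    show "countably_additive (sets (three_moment \<epsilon> \<nu>)) F"
      unfolding countably_additive_def
    proof (intro allI impI)
      fix X :: "nat \<Rightarrow> 'a set"
      assume X: "range X \<subseteq> sets (three_moment \<epsilon> \<nu>)" and dj: "disjoint_family X"
        and U: "\<Union>(range X) \<in> sets (three_moment \<epsilon> \<nu>)"
      have Xm [measurable]: "X n \<in> sets borel" for n using X by auto
      have DU: "D (\<Union>(range X)) = (\<Union>n. D (X n))" by (auto simp: D_def S_def)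
      have djD: "disjoint_family (\<lambda>n. D (X n))"
        using dj unfolding disjoint_family_on_def D_def S_def by blast
      have djI: "disjoint_family (\<lambda>n. X n \<inter> {x. norm x > \<epsilon>})"
        using dj unfolding disjoint_family_on_def by blast
      have 1: "(\<Sum>n. emeasure \<nu> (X n \<inter> {x. norm x > \<epsilon>})) =
          emeasure \<nu> (\<Union>(range X) \<inter> {x. norm x > \<epsilon>})"
        by (subst suminf_emeasure[OF _ djI]) (auto simp: Int_UN_distrib2)
      have 2: "(\<Sum>n. emeasure (density \<nu> p) (D (X n))) = emeasure (density \<nu> p) (D (\<Union>(range X)))"
        unfolding DU by (rule suminf_emeasure[OF _ djD]) (auto simp: s)
      have 3: "(\<Sum>n. emeasure (density (reflected \<nu>) q) (D (X n))) =
          emeasure (density (reflected \<nu>) q) (D (\<Union>(range X)))"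
        unfolding DU by (rule suminf_emeasure[OF _ djD]) (auto simp: s')
      have "(\<Sum>n. F (X n)) = (\<Sum>n. G (X n))" by (simp add: FG)
      also have "\<dots> = G (\<Union>(range X))"
        unfolding G_def by (simp flip: suminf_add add: 1 2 3)
      also have "\<dots> = F (\<Union>(range X))" by (rule FG[symmetric]) simp
      finally show "(\<Sum>n. F (X n)) = F (\<Union>(range X))" .
    qed
  qed (use A in auto)
  then show "emeasure (three_moment \<epsilon> \<nu>) A =
      emeasure \<nu> (A \<inter> {x. norm x > \<epsilon>}) + ennreal (lambda \<epsilon> \<nu> B + lambda_bar \<epsilon> \<nu> B)"
    by (simp add: F_def B_def S_def)
qed

end

theory Submission
  imports Defs
begin

text \<open>
  The three-moment measure has an error \<open>O(\<epsilon> powr (4 - \<alpha>))\<close>, and every Levy measure of at most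
  the same total mass has an error of at least a constant times \<open>\<epsilon> powr (4 - \<alpha>)\<close>. Two
  consequences of the tail hypothesis, valid at all small radii, carry the proof:

  \<^item> the tail of \<open>\<nu>\<close> beyond \<open>r\<close> lies between two multiples of \<open>r powr - \<alpha>\<close>;
  \<^item> since \<open>\<alpha> < 2\<close>, the second moment \<open>V\<close> of \<open>\<nu>\<close> on the ball of radius \<open>\<epsilon>\<close> is
    \<open>O(\<epsilon> powr (2 - \<alpha>))\<close>, by a dyadic decomposition (\<open>truncated_moment_le\<close>).

  For the scheme: it leaves \<open>\<nu>\<close> unchanged outside the ball and puts total mass at most
  \<open>V / \<epsilon>\<^sup>2\<close> on the sphere of radius \<open>\<epsilon>\<close>, because the odd part of the redistributed
  mass cancels over the whole sphere. Hence its error is at most \<open>2 * \<epsilon>\<^sup>2 * V\<close>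
  (\<open>tv_integral_three_moment_le\<close>), and its total mass is at most \<open>L * \<epsilon> powr - \<alpha>\<close>
  for a constant \<open>L\<close>.

  For a competitor \<open>\<nu>'\<close> of at most that mass: take a radius \<open>\<delta> = \<eta> * \<epsilon>\<close> with \<open>\<eta>\<close> so small
  that \<open>\<nu>\<close> gives mass at least \<open>2 * L * \<epsilon> powr - \<alpha>\<close> to \<open>{x. norm x > \<delta>}\<close>. At least half of
  this mass is missing from \<open>\<nu>'\<close>, and each unit of missing mass costs at least \<open>\<delta> ^ 4\<close>
  (\<open>emeasure_le_tv_integral_add\<close>). As \<open>\<eta>\<close> does not depend on \<open>\<epsilon>\<close>, this bound too is a constant
  times \<open>\<epsilon> powr (4 - \<alpha>)\<close>.
\<close>

section \<open>Integration against the total variation\<close>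

text \<open>
  Sigma-finiteness makes the Radon--Nikodym derivatives in \<open>tv_integral\<close> genuine densities.
  Intersections of members of a cover for \<open>M\<close> with members of a cover for \<open>N\<close> have finite
  mass under both measures.
\<close>

lemma sigma_finite_sum_measure:
  assumes M: "sigma_finite_measure M" and N: "sigma_finite_measure N" and s: "sets N = sets M"
  shows "sigma_finite_measure (sum_measure M N)"
proof -
  obtain A where A: "countable A" "A \<subseteq> sets M" "\<Union>A = space M" "\<And>a. a \<in> A \<Longrightarrow> emeasure M a \<noteq> \<infinity>"
    using sigma_finite_measure.sigma_finite_countable[OF M] by metis
  obtain B where B: "countable B" "B \<subseteq> sets N" "\<Union>B = space N" "\<And>b. b \<in> B \<Longrightarrow> emeasure N b \<noteq> \<infinity>"
    using sigma_finite_measure.sigma_finite_countable[OF N] by metis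
  have sp: "space N = space M" using s by (rule sets_eq_imp_space_eq)
  show ?thesis
  proof
    let ?C = "(\<lambda>(a, b). a \<inter> b) ` (A \<times> B)"
    have "emeasure (sum_measure M N) (a \<inter> b) \<noteq> \<infinity>" if "a \<in> A" "b \<in> B" for a b
    proof -
      have ab: "a \<in> sets M" "b \<in> sets M" using that A B s by auto
      have "emeasure M (a \<inter> b) \<le> emeasure M a" "emeasure N (a \<inter> b) \<le> emeasure N b"
        using ab s by (auto intro!: emeasure_mono)
      then have "emeasure M (a \<inter> b) < \<infinity>" "emeasure N (a \<inter> b) < \<infinity>"
        using A(4)[OF that(1)] B(4)[OF that(2)] by (metis infinity_ennreal_def le_less_trans less_top)+
      then show ?thesis using ab s by (simp add: emeasure_sum_measure less_top)
    qed
    moreover have "\<Union>?C = space (sum_measure M N)"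
    proof -
      have "\<Union>?C = \<Union>A \<inter> \<Union>B" by auto
      then show ?thesis using A(3) B(3) sp by simp
    qed
    moreover have "?C \<subseteq> sets (sum_measure M N)" using A(2) B(2) s by auto
    moreover have "countable ?C" using A(1) B(1) by auto
    ultimately show "\<exists>A. countable A \<and> A \<subseteq> sets (sum_measure M N) \<and> \<Union>A = space (sum_measure M N) \<and>
        (\<forall>a\<in>A. emeasure (sum_measure M N) a \<noteq> \<infinity>)"
      by (intro exI[of _ ?C]) auto
  qed
qed

lemma density_RN_deriv_sum_measure:
  assumes M: "sigma_finite_measure M" and N: "sigma_finite_measure N" and s: "sets N = sets M"
  shows "density (sum_measure M N) (RN_deriv (sum_measure M N) M) = M"
    and "density (sum_measure M N) (RN_deriv (sum_measure M N) N) = N"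
proof -
  interpret sigma_finite_measure "sum_measure M N" by (rule sigma_finite_sum_measure[OF assms])
  have ac: "absolutely_continuous (sum_measure M N) M" "absolutely_continuous (sum_measure M N) N"
    by (auto simp: absolutely_continuous_def null_sets_def emeasure_sum_measure s)
  show "density (sum_measure M N) (RN_deriv (sum_measure M N) M) = M"
    by (rule density_RN_deriv[OF ac(1)]) simp
  show "density (sum_measure M N) (RN_deriv (sum_measure M N) N) = N"
    by (rule density_RN_deriv[OF ac(2)]) (simp add: s)
qed

text \<open>
  Outside \<open>D\<close> the densities of \<open>M\<close> and \<open>N\<close> coincide almost everywhere, and on \<open>D\<close> their
  difference is bounded by their sum.
\<close>

lemma tv_integral_le_of_agree_outside:
  assumes M: "sigma_finite_measure M" and N: "sigma_finite_measure N" and s: "sets N = sets M"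
    and f: "f \<in> borel_measurable M" "\<And>x. 0 \<le> f x" and D: "D \<in> sets M"
    and agree: "\<And>A. A \<in> sets M \<Longrightarrow> A \<inter> D = {} \<Longrightarrow> emeasure M A = emeasure N A"
  shows "tv_integral f M N \<le>
    (\<integral>\<^sup>+x. ennreal (f x) * indicator D x \<partial>M) + (\<integral>\<^sup>+x. ennreal (f x) * indicator D x \<partial>N)"
proof -
  define R where "R = sum_measure M N"
  define p where "p = RN_deriv R M"
  define q where "q = RN_deriv R N"
  interpret sigma_finite_measure R
    unfolding R_def by (rule sigma_finite_sum_measure[OF M N s])
  have sR [measurable_cong]: "sets R = sets M" by (simp add: R_def)
  have spR: "space R = space M" by (simp add: R_def)
  note [measurable] = f(1) D
  have [measurable]: "p \<in> borel_measurable R" "q \<in> borel_measurable R"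
    by (simp_all add: p_def q_def)
  have dM: "density R p = M" and dN: "density R q = N"
    unfolding p_def q_def R_def by (rule density_RN_deriv_sum_measure[OF M N s])+
  have "density R (\<lambda>x. indicator (space M - D) x * p x) = density R (\<lambda>x. indicator (space M - D) x * q x)"
  proof (rule measure_eqI)
    fix A assume "A \<in> sets (density R (\<lambda>x. indicator (space M - D) x * p x))"
    then have A [measurable]: "A \<in> sets M" by (simp add: sR)
    have "emeasure (density R (\<lambda>x. indicator (space M - D) x * p x)) A = emeasure (density R p) (A - D)"
      using A sets.sets_into_space[OF A] by (auto simp: emeasure_density sR intro!: nn_integral_cong split: split_indicator)
    also have "\<dots> = emeasure (density R q) (A - D)"
      unfolding dM dN using A D by (intro agree) auto
    also have "\<dots> = emeasure (density R (\<lambda>x. indicator (space M - D) x * q x)) A"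
      using A sets.sets_into_space[OF A] by (auto simp: emeasure_density sR intro!: nn_integral_cong split: split_indicator)
    finally show "emeasure (density R (\<lambda>x. indicator (space M - D) x * p x)) A =
        emeasure (density R (\<lambda>x. indicator (space M - D) x * q x)) A" .
  qed simp
  then have ae: "AE x in R. indicator (space M - D) x * p x = indicator (space M - D) x * q x"
    by (subst (asm) density_unique_iff) auto
  have abs: "ennreal \<bar>enn2real a - enn2real b\<bar> \<le> a + b" for a b
  proof -
    have "ennreal \<bar>enn2real a - enn2real b\<bar> \<le> ennreal (enn2real a + enn2real b)"
      by (intro ennreal_leI) (auto simp: abs_le_iff add_increasing add_increasing2)
    also have "\<dots> = ennreal (enn2real a) + ennreal (enn2real b)" by simp
    also have "\<dots> \<le> a + b"
      by (intro add_mono) (auto simp: ennreal_enn2real_if)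
    finally show ?thesis .
  qed
  have "tv_integral f M N = (\<integral>\<^sup>+x. ennreal (f x) * ennreal \<bar>enn2real (p x) - enn2real (q x)\<bar> \<partial>R)"
    unfolding tv_integral_def Let_def R_def[symmetric] p_def[symmetric] q_def[symmetric]
    using f(2) by (simp add: ennreal_mult)
  also have "\<dots> \<le> (\<integral>\<^sup>+x. p x * (ennreal (f x) * indicator D x) + q x * (ennreal (f x) * indicator D x) \<partial>R)"
  proof (intro nn_integral_mono_AE)
    show "AE x in R. ennreal (f x) * ennreal \<bar>enn2real (p x) - enn2real (q x)\<bar>
      \<le> p x * (ennreal (f x) * indicator D x) + q x * (ennreal (f x) * indicator D x)"
      using ae AE_space
    proof eventually_elim
      case (elim x)
      show ?case
      proof (cases "x \<in> D")
        case True
        have "ennreal (f x) * ennreal \<bar>enn2real (p x) - enn2real (q x)\<bar> \<le> ennreal (f x) * (p x + q x)"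
          by (intro mult_left_mono abs) simp
        then show ?thesis using True by (simp add: distrib_left mult.commute)
      next
        case False
        then show ?thesis using elim by (simp add: spR)
      qed
    qed
  qed
  also have "\<dots> = (\<integral>\<^sup>+x. ennreal (f x) * indicator D x \<partial>density R p) +
      (\<integral>\<^sup>+x. ennreal (f x) * indicator D x \<partial>density R q)"
    by (subst nn_integral_add) (auto simp: nn_integral_density)
  finally show ?thesis unfolding dM dN .
qed

text \<open>
  The source of all lower bounds on the distance: mass of \<open>M\<close> in \<open>A\<close> that \<open>N\<close> lacks costs at
  least \<open>c\<close> per unit. The bound is additive because a difference of extended nonnegative
  numbers would be truncated. It is the integral over \<open>A\<close> of
  \<open>p \<le> \<bar>p - q\<bar> + q\<close>, where \<open>p\<close> and \<open>q\<close> are the densities.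
\<close>

lemma emeasure_le_tv_integral_add:
  assumes M: "sigma_finite_measure M" and N: "sigma_finite_measure N" and s: "sets N = sets M"
    and A: "A \<in> sets M" and f: "f \<in> borel_measurable M" "\<And>x. 0 \<le> f x" "\<And>x. x \<in> A \<Longrightarrow> c \<le> f x"
  shows "ennreal c * emeasure M A \<le> tv_integral f M N + ennreal c * emeasure N A"
proof -
  define R where "R = sum_measure M N"
  define p where "p = RN_deriv R M"
  define q where "q = RN_deriv R N"
  interpret sigma_finite_measure R
    unfolding R_def by (rule sigma_finite_sum_measure[OF M N s])
  have sR [measurable_cong]: "sets R = sets M" by (simp add: R_def)
  note [measurable] = A f(1)
  have [measurable]: "p \<in> borel_measurable R" "q \<in> borel_measurable R"
    by (simp_all add: p_def q_def)
  have dM: "density R p = M" and dN: "density R q = N"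
    unfolding p_def q_def R_def by (rule density_RN_deriv_sum_measure[OF M N s])+
  \<comment> \<open>Where \<open>p\<close> is infinite, \<open>enn2real p = 0\<close> would lose it; where \<open>q\<close> is infinite, the pointwise
     bound is trivial.\<close>
  have fin: "AE x in R. p x \<noteq> \<infinity>"
    unfolding p_def
  proof (rule RN_deriv_finite)
    show "absolutely_continuous R M"
      by (auto simp: R_def absolutely_continuous_def null_sets_def emeasure_sum_measure s)
  qed (use M sR in auto)
  have "ennreal c * emeasure (density R p) A = (\<integral>\<^sup>+x. ennreal c * (p x * indicator A x) \<partial>R)"
    by (subst nn_integral_cmult) (auto simp: emeasure_density)
  also have "\<dots> \<le> (\<integral>\<^sup>+x. ennreal (f x * \<bar>enn2real (p x) - enn2real (q x)\<bar>) +
      ennreal c * (q x * indicator A x) \<partial>R)"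
  proof (intro nn_integral_mono_AE)
    show "AE x in R. ennreal c * (p x * indicator A x) \<le>
      ennreal (f x * \<bar>enn2real (p x) - enn2real (q x)\<bar>) + ennreal c * (q x * indicator A x)"
      using fin
    proof eventually_elim
      case (elim x)
      show ?case
      proof (cases "x \<in> A")
        case True
        have "p x = ennreal (enn2real (p x))" using elim by (simp add: less_top)
        also have "\<dots> \<le> ennreal (\<bar>enn2real (p x) - enn2real (q x)\<bar> + enn2real (q x))"
          by (intro ennreal_leI) linarith
        also have "\<dots> = ennreal \<bar>enn2real (p x) - enn2real (q x)\<bar> + ennreal (enn2real (q x))"
          by (simp del: ennreal_enn2real_if)
        also have "\<dots> \<le> ennreal \<bar>enn2real (p x) - enn2real (q x)\<bar> + q x"
          by (intro add_left_mono) (simp add: ennreal_enn2real_if)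
        finally have "ennreal c * p x \<le> ennreal c * (ennreal \<bar>enn2real (p x) - enn2real (q x)\<bar> + q x)"
          by (intro mult_left_mono) simp_all
        also have "\<dots> \<le> ennreal (f x) * ennreal \<bar>enn2real (p x) - enn2real (q x)\<bar> + ennreal c * q x"
          unfolding distrib_left using f(3)[OF True] by (intro add_mono mult_right_mono ennreal_leI) auto
        finally show ?thesis using True f(2) by (simp add: ennreal_mult)
      next
        case False
        then show ?thesis by simp
      qed
    qed
  qed
  also have "\<dots> = tv_integral f M N + ennreal c * emeasure (density R q) A"
    unfolding tv_integral_def Let_def R_def[symmetric] p_def[symmetric] q_def[symmetric]
    by (subst nn_integral_add) (auto simp: nn_integral_cmult emeasure_density)
  finally show ?thesis unfolding dM dN .
qed

section \<open>Levy measures near the origin\<close>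

lemma levy_measure_tail_finite:
  fixes \<nu> :: "'a::euclidean_space measure"
  assumes lm: "levy_measure \<nu>" and r: "r > 0"
  shows "emeasure \<nu> {x. norm x > r} < \<infinity>"
proof -
  have s [measurable_cong]: "sets \<nu> = sets borel" using lm by (simp add: levy_measure_def)
  define c where "c = min 1 (r\<^sup>2)"
  have c: "c > 0" using r by (simp add: c_def)
  have "ennreal c * emeasure \<nu> {x. norm x > r} = (\<integral>\<^sup>+x. ennreal c * indicator {x. norm x > r} x \<partial>\<nu>)"
    by (subst nn_integral_cmult_indicator) auto
  also have "\<dots> \<le> (\<integral>\<^sup>+ x. ennreal (min 1 ((norm x)\<^sup>2)) \<partial>\<nu>)"
  proof (intro nn_integral_mono)
    fix x :: 'a
    have "c \<le> min 1 ((norm x)\<^sup>2)" if "norm x > r"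
    proof -
      have "r\<^sup>2 \<le> (norm x)\<^sup>2" using that r by (intro power_mono) auto
      then show ?thesis by (auto simp: c_def)
    qed
    then show "ennreal c * indicator {x. norm x > r} x \<le> ennreal (min 1 ((norm x)\<^sup>2))"
      by (auto simp: indicator_def intro!: ennreal_leI)
  qed
  also have "\<dots> < \<infinity>" using lm by (simp add: levy_measure_def)
  finally show ?thesis using c by (auto simp: ennreal_mult_less_top less_top[symmetric])
qed

lemma levy_measure_sigma_finite:
  fixes \<nu> :: "'a::euclidean_space measure"
  assumes lm: "levy_measure \<nu>"
  shows "sigma_finite_measure \<nu>"
proof
  have s [measurable_cong]: "sets \<nu> = sets borel" using lm by (simp add: levy_measure_def)
  have sp: "space \<nu> = UNIV" using sets_eq_imp_space_eq[OF s] by simp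
  let ?C = "insert {0} (range (\<lambda>n. {x::'a. norm x > 1 / real (Suc n)}))"
  have "x \<in> \<Union>?C" for x :: 'a
  proof (cases "x = 0")
    case False
    then obtain n where "inverse (real (Suc n)) < norm x" using reals_Archimedean[of "norm x"] by auto
    then show ?thesis by (auto simp: inverse_eq_divide)
  qed simp
  moreover have "emeasure \<nu> {0} = 0" using lm by (simp add: levy_measure_def)
  moreover have "emeasure \<nu> {x. norm x > 1 / real (Suc n)} \<noteq> \<infinity>" for n
    using levy_measure_tail_finite[OF lm, of "1 / real (Suc n)"] by simp
  moreover have "?C \<subseteq> sets \<nu>" by (auto simp: s)
  ultimately show "\<exists>A. countable A \<and> A \<subseteq> sets \<nu> \<and> \<Union>A = space \<nu> \<and> (\<forall>a\<in>A. emeasure \<nu> a \<noteq> \<infinity>)"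
    by (intro exI[of _ ?C]) (simp add: sp, blast)
qed

text \<open>
  On the shell \<open>\<epsilon> / 2 ^ Suc k < norm x \<le> \<epsilon> / 2 ^ k\<close> the integrand is at most
  \<open>(\<epsilon> / 2 ^ k) ^ m\<close> and the mass is at most that of the tail beyond \<open>\<epsilon> / 2 ^ Suc k\<close>. The
  resulting bounds form a geometric series of ratio \<open>2 powr (\<alpha> - m)\<close>, which is less than 1
  exactly because \<open>\<alpha> < m\<close>.
\<close>

lemma truncated_moment_le:
  fixes \<nu> :: "'a::euclidean_space measure" and A \<alpha> \<epsilon> :: real
  assumes s [measurable_cong]: "sets \<nu> = sets borel" and e: "\<epsilon> > 0" and A: "A \<ge> 0" and m: "0 < m" "\<alpha> < real m"
    and tail: "\<And>r. 0 < r \<Longrightarrow> r \<le> \<epsilon> \<Longrightarrow> emeasure \<nu> {x. norm x > r} \<le> ennreal (A * r powr - \<alpha>)"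
  shows "(\<integral>\<^sup>+x. ennreal (norm x ^ m) * indicator (cball 0 \<epsilon>) x \<partial>\<nu>)
    \<le> ennreal (A * 2 powr \<alpha> / (1 - 2 powr (\<alpha> - real m)) * (\<epsilon> ^ m * \<epsilon> powr - \<alpha>))"
proof -
  define q where "q = 2 powr (\<alpha> - real m)"
  have q: "0 \<le> q" "q < 1"
    using m(2) powr_less_mono[of "\<alpha> - real m" 0 2] by (auto simp: q_def)
  define K where "K = A * 2 powr \<alpha> * (\<epsilon> ^ m * \<epsilon> powr - \<alpha>)"
  have K: "K \<ge> 0" using A e by (simp add: K_def)
  define g where "g k x = ennreal ((\<epsilon> / 2 ^ k) ^ m) * indicator {x. norm x > \<epsilon> / 2 ^ Suc k} x" for k and x :: 'a
  have [measurable]: "g k \<in> borel_measurable \<nu>" for k unfolding g_def by measurable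
  have pt: "ennreal (norm x ^ m) * indicator (cball 0 \<epsilon>) x \<le> (\<Sum>k. g k x)" for x :: 'a
  proof (cases "x \<noteq> 0 \<and> norm x \<le> \<epsilon>")
    case True
    \<comment> \<open>The shell of \<open>x\<close> is found at the first \<open>n\<close> with \<open>\<epsilon> / 2 ^ n < norm x\<close>, by induction.\<close>
    have "\<exists>n. \<epsilon> / 2 ^ n < norm x"
    proof -
      obtain n where "(1/2) ^ n < norm x / \<epsilon>" using real_arch_pow_inv[of "norm x / \<epsilon>" "1/2"] True e by auto
      then show ?thesis using e by (intro exI[of _ n]) (simp add: field_simps power_divide)
    qed
    moreover have "\<not> \<epsilon> / 2 ^ 0 < norm x" using True by simp
    ultimately obtain k where k: "\<not> \<epsilon> / 2 ^ k < norm x" "\<epsilon> / 2 ^ Suc k < norm x"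
      using nat_induct[of "\<lambda>n. \<not> \<epsilon> / 2 ^ n < norm x"] by blast
    have "ennreal (norm x ^ m) * indicator (cball 0 \<epsilon>) x \<le> g k x"
      using k True by (auto simp: g_def intro!: ennreal_leI power_mono)
    also have "\<dots> \<le> (\<Sum>k. g k x)"
      using sum_le_suminf[of "\<lambda>k. g k x" "{k}"] by simp
    finally show ?thesis .
  next
    case False
    then show ?thesis using m(1) by (auto simp: indicator_def zero_power)
  qed
  have int: "(\<integral>\<^sup>+x. g k x \<partial>\<nu>) \<le> ennreal (K * q ^ k)" for k
  proof -
    have "(\<integral>\<^sup>+x. g k x \<partial>\<nu>) = ennreal ((\<epsilon> / 2 ^ k) ^ m) * emeasure \<nu> {x. norm x > \<epsilon> / 2 ^ Suc k}"
      unfolding g_def by (subst nn_integral_cmult_indicator) auto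
    also have "\<dots> \<le> ennreal ((\<epsilon> / 2 ^ k) ^ m) * ennreal (A * (\<epsilon> / 2 ^ Suc k) powr - \<alpha>)"
    proof (intro mult_left_mono tail)
      have "(1::real) \<le> 2 ^ Suc k" by (rule one_le_power) simp
      then show "\<epsilon> / 2 ^ Suc k \<le> \<epsilon>"
        using e by (simp add: divide_le_eq)
    qed (use e in auto)
    also have "\<dots> = ennreal ((\<epsilon> / 2 ^ k) ^ m * (A * (\<epsilon> / 2 ^ Suc k) powr - \<alpha>))"
      using A e by (simp add: ennreal_mult)
    also have "(\<epsilon> / 2 ^ k) ^ m * (A * (\<epsilon> / 2 ^ Suc k) powr - \<alpha>) = K * q ^ k"
    proof -
      have "(\<epsilon> / 2 ^ Suc k) powr - \<alpha> = \<epsilon> powr - \<alpha> * 2 powr (\<alpha> * real (Suc k))"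
        using e by (simp add: powr_divide powr_minus powr_powr mult.commute field_simps flip: powr_realpow del: of_nat_Suc power_Suc)
      moreover have "(\<epsilon> / 2 ^ k) ^ m = \<epsilon> ^ m * 2 powr (- (real k * real m))"
        by (simp add: power_divide powr_minus powr_realpow field_simps flip: power_mult of_nat_mult)
      moreover have "q ^ k = 2 powr ((\<alpha> - real m) * real k)"
        by (simp add: q_def powr_powr flip: powr_realpow)
      moreover have "2 powr (- (real k * real m)) * 2 powr (\<alpha> * real (Suc k)) =
          2 powr \<alpha> * 2 powr ((\<alpha> - real m) * real k)"
        by (simp add: algebra_simps flip: powr_add)
      ultimately show ?thesis by (simp add: K_def)
    qed
    finally show ?thesis .
  qed
  have "(\<integral>\<^sup>+x. ennreal (norm x ^ m) * indicator (cball 0 \<epsilon>) x \<partial>\<nu>) \<le> (\<integral>\<^sup>+x. (\<Sum>k. g k x) \<partial>\<nu>)"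
    by (intro nn_integral_mono pt)
  also have "\<dots> = (\<Sum>k. \<integral>\<^sup>+x. g k x \<partial>\<nu>)" by (rule nn_integral_suminf) simp
  also have "\<dots> \<le> (\<Sum>k. ennreal (K * q ^ k))" by (intro suminf_le int) auto
  also have "\<dots> = ennreal (\<Sum>k. K * q ^ k)"
    using K q by (intro suminf_ennreal2) (auto intro!: summable_mult summable_geometric)
  also have "(\<Sum>k. K * q ^ k) = K / (1 - q)"
    using q by (simp add: suminf_mult summable_geometric suminf_geometric)
  finally show ?thesis by (simp add: K_def q_def)
qed

section \<open>The three-moment scheme\<close>

lemma radial_moment_reflected:
  fixes \<nu> :: "'a::euclidean_space measure"
  assumes s [measurable_cong]: "sets \<nu> = sets borel"
  shows "radial_moment k \<epsilon> (reflected \<nu>) (sphere 0 1) = radial_moment k \<epsilon> \<nu> (sphere 0 1)"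
proof -
  have [measurable]: "sgn \<in> borel_measurable (borel :: 'a measure)"
    unfolding sgn_div_norm by measurable
  show ?thesis
    unfolding radial_moment_def set_lebesgue_integral_def reflected_def
    by (subst integral_distr) (auto simp: indicator_def sgn_minus intro!: Bochner_Integration.integral_cong)
qed

text \<open>
  The redistributed mass. By the previous lemma the signed part \<open>lambda_bar\<close> has total mass zero
  and both halves of \<open>lambda\<close> have the same total mass, so only the truncated second moment is left.
\<close>

lemma emeasure_three_moment_cball:
  fixes \<nu> :: "'a::euclidean_space measure"
  assumes lm: "levy_measure \<nu>" and e: "\<epsilon> > 0"
  shows "emeasure (three_moment \<epsilon> \<nu>) (cball 0 \<epsilon>)
    \<le> ennreal (1 / \<epsilon>\<^sup>2) * (\<integral>\<^sup>+x. ennreal ((norm x)\<^sup>2) * indicator (cball 0 \<epsilon>) x \<partial>\<nu>)"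
proof -
  have s [measurable_cong]: "sets \<nu> = sets borel" using lm by (simp add: levy_measure_def)
  have S: "{\<theta> \<in> sphere 0 1. \<epsilon> *\<^sub>R \<theta> \<in> cball 0 \<epsilon>} = sphere (0::'a) 1"
    using e by (auto simp: dist_norm)
  have E: "cball 0 \<epsilon> \<inter> {x::'a. norm x > \<epsilon>} = {}" by auto
  have [measurable]: "cball (0::'a) \<epsilon> \<in> sets borel" by simp
  define D where "D = {x::'a. norm x \<le> \<epsilon> \<and> sgn x \<in> sphere 0 1}"
  have "emeasure (three_moment \<epsilon> \<nu>) (cball 0 \<epsilon>) = ennreal (radial_moment 2 \<epsilon> \<nu> (sphere 0 1))"
    using emeasure_three_moment(2)[OF lm e, of "cball 0 \<epsilon>", unfolded S E]
    by (simp add: lambda_def lambda_bar_def radial_moment_reflected[OF s])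
  also have "\<dots> = ennreal (LINT x|\<nu>. indicator D x * (norm x ^ 2 / \<epsilon> ^ 2))"
    by (simp add: radial_moment_def set_lebesgue_integral_def D_def)
  also have "\<dots> = (\<integral>\<^sup>+x. ennreal (indicator D x * (norm x ^ 2 / \<epsilon> ^ 2)) \<partial>\<nu>)"
    using radial_moment_integrable[OF lm e, of 2 "sphere 0 1", folded D_def]
    by (intro nn_integral_eq_integral[symmetric]) (auto simp: set_integrable_def)
  also have "\<dots> \<le> (\<integral>\<^sup>+x. ennreal (1 / \<epsilon>\<^sup>2) * (ennreal ((norm x)\<^sup>2) * indicator (cball 0 \<epsilon>) x) \<partial>\<nu>)"
    using e by (intro nn_integral_mono) (auto simp: indicator_def D_def simp flip: ennreal_mult)
  also have "\<dots> = ennreal (1 / \<epsilon>\<^sup>2) * (\<integral>\<^sup>+x. ennreal ((norm x)\<^sup>2) * indicator (cball 0 \<epsilon>) x \<partial>\<nu>)"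
    by (intro nn_integral_cmult) measurable
  finally show ?thesis .
qed

lemma emeasure_three_moment_outside:
  fixes \<nu> :: "'a::euclidean_space measure"
  assumes lm: "levy_measure \<nu>" and e: "\<epsilon> > 0" and A: "A \<in> sets borel" "A \<inter> cball 0 \<epsilon> = {}"
  shows "emeasure (three_moment \<epsilon> \<nu>) A = emeasure \<nu> A"
proof -
  have S: "{\<theta> \<in> sphere 0 1. \<epsilon> *\<^sub>R \<theta> \<in> A} = {}" and E: "A \<inter> {x. norm x > \<epsilon>} = A"
    using A(2) e by (auto simp: disjoint_iff dist_norm not_le)
  show ?thesis
    using emeasure_three_moment(2)[OF lm e A(1), unfolded S E]
    by (simp add: lambda_def lambda_bar_def radial_moment_def set_lebesgue_integral_def)
qed

lemma finite_measure_three_moment: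
  fixes \<nu> :: "'a::euclidean_space measure"
  assumes lm: "levy_measure \<nu>" and e: "\<epsilon> > 0"
  shows "finite_measure (three_moment \<epsilon> \<nu>)"
  using levy_measure_tail_finite[OF lm e]
  by (intro finite_measureI) (simp add: emeasure_three_moment(2)[OF lm e] less_top)

text \<open>
  Only the ball of radius \<open>\<epsilon>\<close> contributes. There \<open>norm x ^ 4 \<le> \<epsilon>\<^sup>2 * (norm x)\<^sup>2\<close> for the share of
  \<open>\<nu>\<close>, and \<open>norm x ^ 4 \<le> \<epsilon> ^ 4\<close> for that of the scheme, whose mass there is at most \<open>1 / \<epsilon>\<^sup>2\<close>
  times the truncated second moment. Both shares have the same bound.
\<close>

lemma tv_integral_three_moment_le:
  fixes \<nu> :: "'a::euclidean_space measure"
  assumes lm: "levy_measure \<nu>" and e: "\<epsilon> > 0"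
  shows "tv_integral (\<lambda>x. norm x ^ 4) \<nu> (three_moment \<epsilon> \<nu>)
    \<le> ennreal (2 * \<epsilon>\<^sup>2) * (\<integral>\<^sup>+x. ennreal ((norm x)\<^sup>2) * indicator (cball 0 \<epsilon>) x \<partial>\<nu>)"
proof -
  have s [measurable_cong]: "sets \<nu> = sets borel" using lm by (simp add: levy_measure_def)
  have [measurable]: "cball (0::'a) \<epsilon> \<in> sets borel" by simp
  let ?N = "three_moment \<epsilon> \<nu>"
  define V where "V = (\<integral>\<^sup>+x. ennreal ((norm x)\<^sup>2) * indicator (cball 0 \<epsilon>) x \<partial>\<nu>)"
  have "(\<integral>\<^sup>+x. ennreal (norm x ^ 4) * indicator (cball 0 \<epsilon>) x \<partial>\<nu>) \<le>
      (\<integral>\<^sup>+x. ennreal (\<epsilon>\<^sup>2) * (ennreal ((norm x)\<^sup>2) * indicator (cball 0 \<epsilon>) x) \<partial>\<nu>)"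
  proof (intro nn_integral_mono)
    fix x :: 'a
    have "norm x ^ 4 \<le> \<epsilon>\<^sup>2 * (norm x)\<^sup>2" if "norm x \<le> \<epsilon>"
    proof -
      have "norm x ^ 4 = (norm x)\<^sup>2 * (norm x)\<^sup>2" by (simp flip: power_add)
      also have "\<dots> \<le> \<epsilon>\<^sup>2 * (norm x)\<^sup>2" using that by (intro mult_right_mono power_mono) auto
      finally show ?thesis .
    qed
    then show "ennreal (norm x ^ 4) * indicator (cball 0 \<epsilon>) x \<le>
        ennreal (\<epsilon>\<^sup>2) * (ennreal ((norm x)\<^sup>2) * indicator (cball 0 \<epsilon>) x)"
      by (auto simp: indicator_def ennreal_leI simp flip: ennreal_mult)
  qed
  also have "\<dots> = ennreal (\<epsilon>\<^sup>2) * V" unfolding V_def by (intro nn_integral_cmult) measurable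
  finally have 1: "(\<integral>\<^sup>+x. ennreal (norm x ^ 4) * indicator (cball 0 \<epsilon>) x \<partial>\<nu>) \<le> ennreal (\<epsilon>\<^sup>2) * V" .

  have "(\<integral>\<^sup>+x. ennreal (norm x ^ 4) * indicator (cball 0 \<epsilon>) x \<partial>?N) \<le>
      (\<integral>\<^sup>+x. ennreal (\<epsilon> ^ 4) * indicator (cball 0 \<epsilon>) x \<partial>?N)"
    by (intro nn_integral_mono) (auto simp: indicator_def intro!: ennreal_leI power_mono)
  also have "\<dots> = ennreal (\<epsilon> ^ 4) * emeasure ?N (cball 0 \<epsilon>)"
    by (intro nn_integral_cmult_indicator) auto
  also have "\<dots> \<le> ennreal (\<epsilon> ^ 4) * (ennreal (1 / \<epsilon>\<^sup>2) * V)"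
    unfolding V_def by (intro mult_left_mono emeasure_three_moment_cball lm e) simp
  also have "\<dots> = ennreal (\<epsilon> ^ 4 * (1 / \<epsilon>\<^sup>2)) * V"
    by (subst ennreal_mult) (auto simp: mult.assoc)
  also have "\<epsilon> ^ 4 * (1 / \<epsilon>\<^sup>2) = \<epsilon>\<^sup>2" using e by (simp add: field_simps flip: power_add)
  finally have 2: "(\<integral>\<^sup>+x. ennreal (norm x ^ 4) * indicator (cball 0 \<epsilon>) x \<partial>?N) \<le> ennreal (\<epsilon>\<^sup>2) * V" .

  have "tv_integral (\<lambda>x. norm x ^ 4) \<nu> ?N \<le>
      (\<integral>\<^sup>+x. ennreal (norm x ^ 4) * indicator (cball 0 \<epsilon>) x \<partial>\<nu>) +
      (\<integral>\<^sup>+x. ennreal (norm x ^ 4) * indicator (cball 0 \<epsilon>) x \<partial>?N)"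
    by (rule tv_integral_le_of_agree_outside[OF levy_measure_sigma_finite[OF lm]
          finite_measure.axioms(1)[OF finite_measure_three_moment[OF lm e]]])
       (auto simp: s emeasure_three_moment_outside[OF lm e])
  also have "\<dots> \<le> ennreal (\<epsilon>\<^sup>2) * V + ennreal (\<epsilon>\<^sup>2) * V" by (rule add_mono[OF 1 2])
  also have "\<dots> = ennreal (2 * \<epsilon>\<^sup>2) * V" by (simp flip: distrib_right ennreal_plus)
  finally show ?thesis unfolding V_def .
qed

section \<open>Comparison with the optimal approximation\<close>

theorem proposition3:
  fixes \<nu> :: "'a::euclidean_space measure" and C \<alpha> :: real
  assumes "levy_measure \<nu>"
    and "(\<integral>\<^sup>+ x. ennreal (norm x ^ 3) \<partial>\<nu>) < \<infinity>"
    and "C > 0" and "0 < \<alpha>" and "\<alpha> < 2"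
    and "(\<lambda>r. measure \<nu> {x. norm x > r}) \<sim>[at_right 0] (\<lambda>r. C * r powr (- \<alpha>))"
  shows "Limsup (at_right 0) (\<lambda>\<epsilon>.
           tv_integral (\<lambda>x. norm x ^ 4) \<nu> (three_moment \<epsilon> \<nu>) /
           (INF \<nu>' \<in> levy_measures_le (emeasure (three_moment \<epsilon> \<nu>) UNIV).
              tv_integral (\<lambda>x. norm x ^ 4) \<nu> \<nu>')) < \<infinity>"
proof -
  note lm = assms(1) and C = \<open>C > 0\<close> and \<alpha> = \<open>0 < \<alpha>\<close> \<open>\<alpha> < 2\<close>
  have s [measurable_cong]: "sets \<nu> = sets borel" using lm by (simp add: levy_measure_def)
  have sf: "sigma_finite_measure \<nu>" by (rule levy_measure_sigma_finite[OF lm])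
  have tail_eq: "emeasure \<nu> {x. norm x > r} = ennreal (measure \<nu> {x. norm x > r})" if "r > 0" for r
    using levy_measure_tail_finite[OF lm that] by (simp add: emeasure_eq_ennreal_measure)

  have "((\<lambda>r. measure \<nu> {x. norm x > r} / (C * r powr - \<alpha>)) \<longlongrightarrow> 1) (at_right 0)"
    using assms(6) C by (intro asymp_equivD_strong) (auto intro!: eventually_mono[OF eventually_at_right_less[of 0]])
  then have "\<forall>\<^sub>F r in at_right 0. dist (measure \<nu> {x. norm x > r} / (C * r powr - \<alpha>)) 1 < 1/2"
    by (rule tendstoD) simp
  then obtain r0 where r0: "r0 > 0"
    "\<And>r. 0 < r \<Longrightarrow> r < r0 \<Longrightarrow> dist (measure \<nu> {x. norm x > r} / (C * r powr - \<alpha>)) 1 < 1/2"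
    unfolding eventually_at_right_field by auto
  have bounds: "C / 2 * r powr - \<alpha> \<le> measure \<nu> {x. norm x > r}"
      "measure \<nu> {x. norm x > r} \<le> 2 * C * r powr - \<alpha>" if r: "0 < r" "r < r0" for r
  proof -
    have pos: "C * r powr - \<alpha> > 0" using C r by simp
    define u where "u = measure \<nu> {x. norm x > r} / (C * r powr - \<alpha>)"
    have "dist u 1 < 1/2" using r0(2)[OF r] by (simp only: u_def)
    then have u: "1/2 \<le> u" "u \<le> 2" unfolding dist_real_def by linarith+
    have eq: "measure \<nu> {x. norm x > r} = u * (C * r powr - \<alpha>)"
      using pos nonzero_eq_divide_eq[of "C * r powr - \<alpha>" u] u_def by auto
    show "C / 2 * r powr - \<alpha> \<le> measure \<nu> {x. norm x > r}"
      "measure \<nu> {x. norm x > r} \<le> 2 * C * r powr - \<alpha>"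
      unfolding eq using mult_right_mono[OF u(1), of "C * r powr - \<alpha>"]
        mult_right_mono[OF u(2), of "C * r powr - \<alpha>"] pos by auto
  qed

  \<comment> \<open>\<open>K\<close> bounds the truncated second moment, \<open>L\<close> the total mass of the scheme. The number
     \<open>\<eta>\<close> is chosen so that \<open>C / 2 * \<eta> powr - \<alpha> = 2 * L\<close>: the tail of \<open>\<nu>\<close> beyond \<open>\<eta> * \<epsilon>\<close> has
     at least twice the mass that a competitor may use.\<close>
  define K where "K = 2 * C * 2 powr \<alpha> / (1 - 2 powr (\<alpha> - 2))"
  have K: "K > 0"
    unfolding K_def using C \<alpha>(2) powr_less_mono[of "\<alpha> - 2" 0 2] by (intro divide_pos_pos) auto
  define L where "L = 2 * C + K"
  have L: "L > 0" using C K by (simp add: L_def)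
  define \<eta> where "\<eta> = (4 * L / C) powr (- (1 / \<alpha>))"
  have \<eta>: "0 < \<eta>" using L C by (simp add: \<eta>_def)
  have \<eta>1: "\<eta> \<le> 1"
  proof -
    have "1 \<le> 4 * L / C" using C K by (simp add: L_def field_simps)
    then show ?thesis unfolding \<eta>_def using \<alpha>(1) L C powr_mono[of "- (1 / \<alpha>)" 0 "4 * L / C"] by simp
  qed
  have \<eta>\<alpha>: "\<eta> powr - \<alpha> = 4 * L / C" using \<alpha>(1) L C by (simp add: \<eta>_def powr_powr)

  have main: "tv_integral (\<lambda>x. norm x ^ 4) \<nu> (three_moment \<epsilon> \<nu>) /
           (INF \<nu>' \<in> levy_measures_le (emeasure (three_moment \<epsilon> \<nu>) UNIV).
              tv_integral (\<lambda>x. norm x ^ 4) \<nu> \<nu>') \<le> ennreal (2 * K / (\<eta> ^ 4 * L))"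
    if e: "0 < \<epsilon>" "\<epsilon> < r0" for \<epsilon>
  proof -
    define t where "t = \<epsilon> powr - \<alpha>"
    have t: "t > 0" using e by (simp add: t_def)
    define V where "V = (\<integral>\<^sup>+x. ennreal ((norm x)\<^sup>2) * indicator (cball 0 \<epsilon>) x \<partial>\<nu>)"
    have V: "V \<le> ennreal (K * \<epsilon>\<^sup>2 * t)"
      using truncated_moment_le[OF s e(1), of "2 * C" 2 \<alpha>] C \<alpha>(2) e bounds
      by (auto simp: V_def K_def t_def tail_eq mult.assoc ennreal_leI)
    let ?N = "three_moment \<epsilon> \<nu>"
    have inner: "emeasure ?N (cball 0 \<epsilon>) \<le> ennreal (K * t)"
    proof -
      have "emeasure ?N (cball 0 \<epsilon>) \<le> ennreal (1 / \<epsilon>\<^sup>2) * V"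
        unfolding V_def by (rule emeasure_three_moment_cball[OF lm e(1)])
      also have "\<dots> \<le> ennreal (1 / \<epsilon>\<^sup>2) * ennreal (K * \<epsilon>\<^sup>2 * t)" by (intro mult_left_mono V) simp
      also have "\<dots> = ennreal (K * t)" using e K t by (simp flip: ennreal_mult)
      finally show ?thesis .
    qed
    have total: "emeasure ?N UNIV \<le> ennreal (L * t)"
    proof -
      have "emeasure ?N UNIV = emeasure ?N (cball 0 \<epsilon> \<union> {x. norm x > \<epsilon>})"
        by (rule arg_cong[where f="emeasure ?N"]) auto
      also have "\<dots> \<le> emeasure ?N (cball 0 \<epsilon>) + emeasure ?N {x. norm x > \<epsilon>}"
        by (rule emeasure_subadditive) auto
      also have "emeasure ?N {x. norm x > \<epsilon>} = emeasure \<nu> {x. norm x > \<epsilon>}"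
        by (rule emeasure_three_moment_outside[OF lm e(1)]) auto
      also have "emeasure ?N (cball 0 \<epsilon>) + emeasure \<nu> {x. norm x > \<epsilon>} \<le> ennreal (K * t) + ennreal (2 * C * t)"
        using bounds(2)[OF e] e by (intro add_mono inner) (auto simp: tail_eq t_def intro!: ennreal_leI)
      also have "\<dots> = ennreal (L * t)" using K C t by (simp add: L_def algebra_simps flip: ennreal_plus)
      finally show ?thesis .
    qed
    have num: "tv_integral (\<lambda>x. norm x ^ 4) \<nu> ?N \<le> ennreal (2 * K * (\<epsilon> ^ 4 * t))"
    proof -
      have "tv_integral (\<lambda>x. norm x ^ 4) \<nu> ?N \<le> ennreal (2 * \<epsilon>\<^sup>2) * V"
        unfolding V_def by (rule tv_integral_three_moment_le[OF lm e(1)])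
      also have "\<dots> \<le> ennreal (2 * \<epsilon>\<^sup>2) * ennreal (K * \<epsilon>\<^sup>2 * t)" by (intro mult_left_mono V) simp
      also have "\<dots> = ennreal (2 * K * (\<epsilon> ^ 4 * t))"
        using K t e by (subst ennreal_mult[symmetric]) (auto simp: power4_eq_xxxx power2_eq_square mult_ac)
      finally show ?thesis .
    qed

    have den: "ennreal (\<eta> ^ 4 * L * (\<epsilon> ^ 4 * t)) \<le>
        (INF \<nu>' \<in> levy_measures_le (emeasure ?N UNIV). tv_integral (\<lambda>x. norm x ^ 4) \<nu> \<nu>')"
    proof (rule INF_greatest)
      fix \<nu>' :: "'a measure" assume "\<nu>' \<in> levy_measures_le (emeasure ?N UNIV)"
      then have lm': "levy_measure \<nu>'" and mass: "emeasure \<nu>' UNIV \<le> ennreal (L * t)"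
        using total by (auto simp: levy_measures_le_def)
      have s' [measurable_cong]: "sets \<nu>' = sets borel" using lm' by (simp add: levy_measure_def)
      define \<delta> where "\<delta> = \<eta> * \<epsilon>"
      have \<delta>: "0 < \<delta>" "\<delta> < r0"
      proof -
        show "0 < \<delta>" using \<eta> e by (simp add: \<delta>_def)
        have "\<delta> \<le> \<epsilon>" unfolding \<delta>_def using \<eta> \<eta>1 e by (intro mult_left_le_one_le) auto
        then show "\<delta> < r0" using e by linarith
      qed
      let ?A = "{x::'a. norm x > \<delta>}"
      have "2 * L * t = C / 2 * \<delta> powr - \<alpha>"
        using \<eta> e C \<eta>\<alpha> by (simp add: \<delta>_def t_def powr_mult)
      then have A: "ennreal (2 * L * t) \<le> emeasure \<nu> ?A"
        using bounds(1)[OF \<delta>] \<delta>(1) by (auto simp: tail_eq intro!: ennreal_leI)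
      have A': "emeasure \<nu>' ?A \<le> ennreal (L * t)"
        using mass by (rule order_trans[rotated]) (auto intro!: emeasure_mono simp: s')
      have "ennreal (\<delta> ^ 4 * (L * t)) + ennreal (\<delta> ^ 4 * (L * t)) = ennreal (\<delta> ^ 4) * ennreal (2 * L * t)"
        using \<delta> L t by (simp flip: ennreal_mult ennreal_plus)
      also have "\<dots> \<le> ennreal (\<delta> ^ 4) * emeasure \<nu> ?A" by (intro mult_left_mono A) simp
      also have "\<dots> \<le> tv_integral (\<lambda>x. norm x ^ 4) \<nu> \<nu>' + ennreal (\<delta> ^ 4) * emeasure \<nu>' ?A"
        using \<delta>(1)
        by (intro emeasure_le_tv_integral_add sf levy_measure_sigma_finite[OF lm'])
           (auto simp: s s' intro!: power_mono)
      also have "\<dots> \<le> tv_integral (\<lambda>x. norm x ^ 4) \<nu> \<nu>' + ennreal (\<delta> ^ 4) * ennreal (L * t)"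
        by (intro add_left_mono mult_left_mono A') simp
      also have "ennreal (\<delta> ^ 4) * ennreal (L * t) = ennreal (\<delta> ^ 4 * (L * t))"
        using \<delta> L t by (simp add: ennreal_mult)
      finally have "ennreal (\<delta> ^ 4 * (L * t)) \<le> tv_integral (\<lambda>x. norm x ^ 4) \<nu> \<nu>'"
        by (metis add.commute ennreal_add_left_cancel_le ennreal_neq_top infinity_ennreal_def)
      then show "ennreal (\<eta> ^ 4 * L * (\<epsilon> ^ 4 * t)) \<le> tv_integral (\<lambda>x. norm x ^ 4) \<nu> \<nu>'"
        by (simp add: \<delta>_def power_mult_distrib mult_ac)
    qed

    show ?thesis
    proof (rule divide_le_posI_ennreal)
      let ?I = "INF \<nu>' \<in> levy_measures_le (emeasure ?N UNIV). tv_integral (\<lambda>x. norm x ^ 4) \<nu> \<nu>'"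
      have "0 < ennreal (\<eta> ^ 4 * L * (\<epsilon> ^ 4 * t))" using \<eta> L e t by simp
      then show "0 < ?I" using den by (rule less_le_trans)
      note num
      also have "ennreal (2 * K * (\<epsilon> ^ 4 * t)) =
          ennreal (\<eta> ^ 4 * L * (\<epsilon> ^ 4 * t)) * ennreal (2 * K / (\<eta> ^ 4 * L))"
        using \<eta> L K e t by (subst ennreal_mult[symmetric]) auto
      also have "\<dots> \<le> ?I * ennreal (2 * K / (\<eta> ^ 4 * L))" by (intro mult_right_mono den) simp
      finally show "tv_integral (\<lambda>x. norm x ^ 4) \<nu> ?N \<le> ?I * ennreal (2 * K / (\<eta> ^ 4 * L))" .
    qed
  qed
  have "Limsup (at_right 0) (\<lambda>\<epsilon>.
           tv_integral (\<lambda>x. norm x ^ 4) \<nu> (three_moment \<epsilon> \<nu>) /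
           (INF \<nu>' \<in> levy_measures_le (emeasure (three_moment \<epsilon> \<nu>) UNIV).
              tv_integral (\<lambda>x. norm x ^ 4) \<nu> \<nu>')) \<le> ennreal (2 * K / (\<eta> ^ 4 * L))"
    by (rule Limsup_bounded) (use main r0(1) in \<open>auto simp: eventually_at_right_field\<close>)
  also have "\<dots> < \<infinity>" by simp
  finally show ?thesis .
qed

end
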